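(* Let $k\in C^\infty(\mathbb{R})$ be real-valued and such that $\lim_{u\to-\infty}k'(u)$ and $\lim_{u\to\infty}k'(u)$ exist (in $\mathbb{R}$). For the metric $h_{ij}=e^{2k(u)}\delta_{ij}$ on the noncommutative cylinder, the total curvature is $$\tau_h(K)=\lim_{u\to-\infty}k'(u)-\lim_{u\to\infty}k'(u).$$ Moreover, if $\delta\in C^\infty(\mathbb{R})$ is real-valued with $\lim_{u\to\infty}\delta'(u)=\lim_{u\to-\infty}\delta'(u)$ (existing in $\mathbb{R}$), then the metric $\tilde h_{ij}=e^{2\tilde k(u)}\delta_{ij}$, with $\tilde k=k+\delta$, has the same total curvature: $\tau_{\tilde h}(\tilde K)=\tau_h(K)$.
   Context: $\widehat{\mathcal{C}}_\hbar^\infty$ ($\hbar\in\mathbb{R}$) is the $*$-algebra of finite sums $f=\sum_nf_n(u)W^n$, $f_n\in C^\infty(\mathbb{R})$, $W=e^{2\pi it}$, with product $fg=\sum_{n}\big[\sum_{k}f_k(u)g_{n-k}(u+k\hbar)\big]W^n$, involution $f^*=\sum_n\overline{f_{-n}(u+n\hbar)}W^n$, and derivations $\partial_1f=\sum_nf'_nW^n$, $\partial_2f=2\pi i\sum_nnf_nW^n$. On the free right module with basis $e_1,e_2$ and hermitian form $h(X,Y)=(X^i)^*h_{ij}Y^j$ with $h_{ij}=e^{2k(u)}\delta_{ij}$, the Levi-Civita connection (the unique affine connection $\nabla$ that is metric, torsion-free in the sense $\nabla_ie_j=\nabla_je_i$, and with $h(\nabla_ie_j,e_l)$ hermitian) is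 $\nabla_1e_1=e_1k'$, $\nabla_1e_2=\nabla_2e_1=e_2k'$, $\nabla_2e_2=-e_1k'$. With $R(\partial_i,\partial_j)=\nabla_i\nabla_j-\nabla_j\nabla_i$ and $R_{ijkl}=h(e_i,R(\partial_k,\partial_l)e_j)$, the Gaussian curvature is $K=\frac12h^{ij}R_{ikjl}h^{kl}$ (where $h^{ij}=e^{-2k(u)}\delta^{ij}$, repeated indices summed); explicitly $K=-e^{-2k(u)}k''(u)$. The Riemannian integral is $\tau_h(f)=\tau(fe^{2k(u)})$ with $\tau(f)=\int_{-\infty}^\infty f_0(u)\,du$ (improper integral, $f_0$ the coefficient of $W^0$), and the total curvature is $\tau_h(K)$; $\tilde K$ and $\tau_{\tilde h}$ denote the corresponding objects for $\tilde h$. *)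

theory Defs
  imports "HOL-Analysis.Analysis"
begin

section \<open>Smooth functions of a real variable\<close>

abbreviation vderiv :: "(real \<Rightarrow> 'a::real_normed_vector) \<Rightarrow> real \<Rightarrow> 'a" where
  "vderiv f \<equiv> (\<lambda>u. vector_derivative f (at u))"

definition Cn :: "nat \<Rightarrow> (real \<Rightarrow> 'a::real_normed_vector) \<Rightarrow> bool" where
  "Cn n f \<longleftrightarrow> (\<forall>m<n. \<forall>u. (vderiv ^^ m) f differentiable (at u))"

definition smooth :: "(real \<Rightarrow> 'a::real_normed_vector) \<Rightarrow> bool" where
  "smooth f \<longleftrightarrow> (\<forall>n u. (vderiv ^^ n) f differentiable (at u))"

lemma smooth_Cn: "smooth f \<longleftrightarrow> (\<forall>n. Cn n f)"
  unfolding smooth_def Cn_def by blast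

lemma Cn_0: "Cn 0 f"
  by (simp add: Cn_def)

lemma Cn_Suc: "Cn (Suc n) f \<longleftrightarrow> (\<forall>u. f differentiable (at u)) \<and> Cn n (vderiv f)"
  unfolding Cn_def by (auto simp: All_less_Suc2 funpow_Suc_right simp del: funpow.simps)

lemma Cn_mono: "Cn n f \<Longrightarrow> m \<le> n \<Longrightarrow> Cn m f"
  by (auto simp: Cn_def)

lemma smooth_vderiv: "smooth f \<Longrightarrow> smooth (vderiv f)"
  unfolding smooth_Cn using Cn_Suc by blast

lemma Cn_const: "Cn n (\<lambda>u. c)"
proof (induction n arbitrary: c)
  case (Suc n)
  have "vderiv (\<lambda>u::real. c) = (\<lambda>u. 0)" by (simp add: fun_eq_iff)
  then show ?case using Suc by (simp add: Cn_Suc)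
qed (rule Cn_0)

lemma Cn_add: "Cn n f \<Longrightarrow> Cn n g \<Longrightarrow> Cn n (\<lambda>u. f u + g u)"
proof (induction n arbitrary: f g)
  case (Suc n)
  then have d: "\<And>u. f differentiable (at u)" "\<And>u. g differentiable (at u)" by (auto simp: Cn_Suc)
  have "vderiv (\<lambda>u. f u + g u) = (\<lambda>u. vderiv f u + vderiv g u)"
    using d by (auto simp: fun_eq_iff intro!: vector_derivative_at has_vector_derivative_add
        simp: vector_derivative_works[symmetric])
  then show ?case using Suc d by (auto simp: Cn_Suc intro!: derivative_intros)
qed (rule Cn_0)

lemma Cn_bounded_linear:
  assumes L: "bounded_linear L" 
  shows "Cn n f \<Longrightarrow> Cn n (\<lambda>u. L (f u))"
proof (induction n arbitrary: f)
  case (Suc n)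
  then have d: "\<And>u. f differentiable (at u)" by (auto simp: Cn_Suc)
  have v: "((\<lambda>u. L (f u)) has_vector_derivative L (vderiv f u)) (at u)" for u
    by (rule bounded_linear.has_vector_derivative[OF L])
       (use d vector_derivative_works in blast)
  then have "vderiv (\<lambda>u. L (f u)) = (\<lambda>u. L (vderiv f u))"
    by (auto simp: fun_eq_iff intro!: vector_derivative_at)
  then show ?case using Suc v by (auto simp: Cn_Suc intro: differentiableI_vector)
qed (rule Cn_0)

lemma Cn_mult:
  fixes f g :: "real \<Rightarrow> 'a::real_normed_algebra"
  shows "Cn n f \<Longrightarrow> Cn n g \<Longrightarrow> Cn n (\<lambda>u. f u * g u)"
proof (induction n arbitrary: f g)
  case (Suc n)
  then have d: "\<And>u. f differentiable (at u)" "\<And>u. g differentiable (at u)" by (auto simp: Cn_Suc)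
  have v: "((\<lambda>u. f u * g u) has_vector_derivative (f u * vderiv g u + vderiv f u * g u)) (at u)" for u
    by (rule has_vector_derivative_mult) (use d vector_derivative_works in blast)+
  then have e: "vderiv (\<lambda>u. f u * g u) = (\<lambda>u. f u * vderiv g u + vderiv f u * g u)"
    by (auto simp: fun_eq_iff intro!: vector_derivative_at)
  have "Cn n f" "Cn n g" using Suc.prems Cn_mono le_SucI by blast+
  then show ?case using Suc v unfolding Cn_Suc e
    by (auto intro: differentiableI_vector Cn_add)
qed (rule Cn_0)

lemma Cn_shift: "Cn n f \<Longrightarrow> Cn n (\<lambda>u. f (u + c))"
proof (induction n arbitrary: f)
  case (Suc n)
  then have d: "\<And>u. f differentiable (at u)" by (auto simp: Cn_Suc)
  have v: "((\<lambda>u. f (u + c)) has_vector_derivative vderiv f (u + c)) (at u)" for u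
  proof -
    have "(f has_vector_derivative vderiv f (u + c)) (at (u + c))"
      using d vector_derivative_works by blast
    then have "((f \<circ> (\<lambda>u. u + c)) has_vector_derivative 1 *\<^sub>R vderiv f (u + c)) (at u)"
      by (intro vector_diff_chain_at) (auto intro!: derivative_eq_intros)
    then show ?thesis by (simp add: o_def)
  qed
  then have "vderiv (\<lambda>u. f (u + c)) = (\<lambda>u. vderiv f (u + c))"
    by (auto simp: fun_eq_iff intro!: vector_derivative_at)
  then show ?case using Suc v by (auto simp: Cn_Suc intro: differentiableI_vector)
qed (rule Cn_0)

lemma smooth_const: "smooth (\<lambda>u. c)"
  by (simp add: smooth_Cn Cn_const)

lemma smooth_add: "smooth f \<Longrightarrow> smooth g \<Longrightarrow> smooth (\<lambda>u. f u + g u)"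
  by (simp add: smooth_Cn Cn_add)

lemma smooth_shift: "smooth f \<Longrightarrow> smooth (\<lambda>u. f (u + c))"
  by (simp add: smooth_Cn Cn_shift)

lemma smooth_bounded_linear: "bounded_linear L \<Longrightarrow> smooth f \<Longrightarrow> smooth (\<lambda>u. L (f u))"
  by (simp add: smooth_Cn Cn_bounded_linear)

lemma smooth_mult:
  fixes f g :: "real \<Rightarrow> 'a::real_normed_algebra"
  shows "smooth f \<Longrightarrow> smooth g \<Longrightarrow> smooth (\<lambda>u. f u * g u)"
  by (auto simp: smooth_Cn intro: Cn_mult)

lemma smooth_sum: "(\<And>i. i \<in> A \<Longrightarrow> smooth (f i)) \<Longrightarrow> smooth (\<lambda>u. \<Sum>i\<in>A. f i u)"
  by (induction A rule: infinite_finite_induct) (auto intro: smooth_const smooth_add)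


section \<open>The noncommutative cylinder\<close>

text \<open>
  An element \<open>\<Sum>n. f\<^sub>n(u) W\<^sup>n\<close> is encoded by its coefficient family. The underlying vector space
  does not depend on \<open>hbar\<close>; the product and the involution take \<open>hbar\<close> as a parameter.
\<close>

typedef cyl = "{f :: int \<Rightarrow> real \<Rightarrow> complex. finite {n. f n \<noteq> (\<lambda>u. 0)} \<and> (\<forall>n. smooth (f n))}"
  morphisms coeff Abs_cyl
  by (rule exI[of _ "\<lambda>n u. 0"]) (simp add: smooth_const)

setup_lifting type_definition_cyl

instantiation cyl :: real_vector
begin

lift_definition zero_cyl :: cyl is "\<lambda>n u. 0"
  by (simp add: smooth_const)

lift_definition plus_cyl :: "cyl \<Rightarrow> cyl \<Rightarrow> cyl" is "\<lambda>f g n u. f n u + g n u"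
  subgoal for f g
    by (auto intro!: smooth_add
        intro: finite_subset[of _ "{n. f n \<noteq> (\<lambda>u. 0)} \<union> {n. g n \<noteq> (\<lambda>u. 0)}"])
  done

lift_definition uminus_cyl :: "cyl \<Rightarrow> cyl" is "\<lambda>f n u. - f n u"
  subgoal for f
    by (auto intro!: smooth_bounded_linear[OF bounded_linear_minus[OF bounded_linear_ident]]
        intro: finite_subset[of _ "{n. f n \<noteq> (\<lambda>u. 0)}"])
  done

lift_definition scaleR_cyl :: "real \<Rightarrow> cyl \<Rightarrow> cyl" is "\<lambda>r f n u. r *\<^sub>R f n u"
  subgoal for r f
    by (auto intro!: smooth_bounded_linear[OF bounded_linear_scaleR_right]
        intro: finite_subset[of _ "{n. f n \<noteq> (\<lambda>u. 0)}"])
  done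

definition minus_cyl :: "cyl \<Rightarrow> cyl \<Rightarrow> cyl" where
  "minus_cyl f g = f + - g"

instance
  by standard (unfold minus_cyl_def, (transfer; simp add: fun_eq_iff algebra_simps)+)

end

lift_definition cyl_mult :: "real \<Rightarrow> cyl \<Rightarrow> cyl \<Rightarrow> cyl"
  is "\<lambda>hbar f g n u. \<Sum>m | f m \<noteq> (\<lambda>u. 0). f m u * g (n - m) (u + of_int m * hbar)"
  subgoal for hbar f g
  proof -
    assume f: "finite {n. f n \<noteq> (\<lambda>u. 0)} \<and> (\<forall>n. smooth (f n))"
      and g: "finite {n. g n \<noteq> (\<lambda>u. 0)} \<and> (\<forall>n. smooth (g n))"
    let ?F = "{n. f n \<noteq> (\<lambda>u. 0)}" and ?G = "{n. g n \<noteq> (\<lambda>u. 0)}"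
    let ?p = "\<lambda>n u. \<Sum>m\<in>?F. f m u * g (n - m) (u + of_int m * hbar)"
    have "{n. ?p n \<noteq> (\<lambda>u. 0)} \<subseteq> (\<lambda>(a, b). a + b) ` (?F \<times> ?G)"
    proof
      fix n assume "n \<in> {n. ?p n \<noteq> (\<lambda>u. 0)}"
      then obtain u where "?p n u \<noteq> 0" by (auto simp: fun_eq_iff)
      then obtain m where m: "m \<in> ?F" "f m u * g (n - m) (u + of_int m * hbar) \<noteq> 0"
        by (meson sum.not_neutral_contains_not_neutral)
      then have "n - m \<in> ?G" by auto
      with m(1) have "(m, n - m) \<in> ?F \<times> ?G" by blast
      then show "n \<in> (\<lambda>(a, b). a + b) ` (?F \<times> ?G)"
        by (intro image_eqI[of _ _ "(m, n - m)"]) auto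
    qed
    then have "finite {n. ?p n \<noteq> (\<lambda>u. 0)}"
      by (rule finite_subset) (use f g in blast)
    moreover have "smooth (?p n)" for n
      using f g by (intro smooth_sum smooth_mult smooth_shift) auto
    ultimately show ?thesis by blast
  qed
  done

abbreviation cyl_mult_syntax (\<open>_ \<star>\<^bsub>_\<^esub> _\<close> [70, 0, 71] 70) where
  "f \<star>\<^bsub>hbar\<^esub> g \<equiv> cyl_mult hbar f g"

lift_definition cyl_star :: "real \<Rightarrow> cyl \<Rightarrow> cyl"
  is "\<lambda>hbar f n u. cnj (f (- n) (u + of_int n * hbar))"
  subgoal for hbar f
  proof -
    assume f: "finite {n. f n \<noteq> (\<lambda>u. 0)} \<and> (\<forall>n. smooth (f n))"
    have "{n. (\<lambda>u. cnj (f (- n) (u + of_int n * hbar))) \<noteq> (\<lambda>u. 0)} \<subseteq> uminus ` {n. f n \<noteq> (\<lambda>u. 0)}"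
      by (auto intro!: image_eqI[of _ uminus "- _"])
    then have "finite {n. (\<lambda>u. cnj (f (- n) (u + of_int n * hbar))) \<noteq> (\<lambda>u. 0)}"
      by (rule finite_subset) (use f in blast)
    moreover have "smooth (\<lambda>u. cnj (f (- n) (u + of_int n * hbar)))" for n
      using f by (intro smooth_bounded_linear[OF bounded_linear_cnj] smooth_shift) auto
    ultimately show ?thesis by blast
  qed
  done

lift_definition cyl_d1 :: "cyl \<Rightarrow> cyl" is "\<lambda>f n. vderiv (f n)"
  subgoal for f
    by (auto intro!: smooth_vderiv intro: finite_subset[of _ "{n. f n \<noteq> (\<lambda>u. 0)}"])
  done

lift_definition cyl_d2 :: "cyl \<Rightarrow> cyl" is "\<lambda>f n u. 2 * of_real pi * \<i> * of_int n * f n u"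
  subgoal for f
    by (auto intro!: smooth_mult smooth_const intro: finite_subset[of _ "{n. f n \<noteq> (\<lambda>u. 0)}"])
  done

definition cyl_deriv :: "2 \<Rightarrow> cyl \<Rightarrow> cyl" where
  "cyl_deriv i = (if i = 1 then cyl_d1 else cyl_d2)"

text \<open>
  A smooth function \<open>g(u)\<close> as the element \<open>g W\<^sup>0\<close>. For a function that is not smooth the value
  is the dummy \<open>0\<close>.
\<close>

lift_definition cyl_fun :: "(real \<Rightarrow> complex) \<Rightarrow> cyl"
  is "\<lambda>g n. if n = 0 \<and> smooth g then g else (\<lambda>u. 0)"
  subgoal for g
    by (auto simp: smooth_const intro: finite_subset[of _ "{0}"])
  done


section \<open>Levi-Civita connection and curvature\<close>

text \<open>
  The free right module on \<open>e\<^sub>1, e\<^sub>2\<close> is \<^typ>\<open>cyl^2\<close>. Note that \<open>2 = 0\<close> in the index type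
  \<^typ>\<open>2\<close>, whose two elements are \<open>1\<close> and \<open>2\<close>.
\<close>

definition rmult :: "real \<Rightarrow> cyl^2 \<Rightarrow> cyl \<Rightarrow> cyl^2" where
  "rmult hbar X f = (\<chi> i. X $ i \<star>\<^bsub>hbar\<^esub> f)"

definition basis :: "2 \<Rightarrow> cyl^2" where
  "basis j = axis j (cyl_fun (\<lambda>u. 1))"

definition herm_form :: "real \<Rightarrow> (2 \<Rightarrow> 2 \<Rightarrow> cyl) \<Rightarrow> cyl^2 \<Rightarrow> cyl^2 \<Rightarrow> cyl" where
  "herm_form hbar h X Y = (\<Sum>i\<in>UNIV. \<Sum>j\<in>UNIV. cyl_star hbar (X $ i) \<star>\<^bsub>hbar\<^esub> h i j \<star>\<^bsub>hbar\<^esub> Y $ j)"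

text \<open>
  Since the Lie algebra of derivations is spanned by \<open>\<partial>\<^sub>1, \<partial>\<^sub>2\<close>, a connection is given by the
  two maps \<open>\<nabla>\<^sub>1, \<nabla>\<^sub>2\<close>. Homogeneity over the complex numbers follows from the Leibniz rule applied
  to constant functions.
\<close>

definition affine_connection :: "real \<Rightarrow> (2 \<Rightarrow> cyl^2 \<Rightarrow> cyl^2) \<Rightarrow> bool" where
  "affine_connection hbar D \<longleftrightarrow>
     (\<forall>i X Y. D i (X + Y) = D i X + D i Y) \<and>
     (\<forall>i X f. D i (rmult hbar X f) = rmult hbar (D i X) f + rmult hbar X (cyl_deriv i f))"

definition is_levi_civita ::
    "real \<Rightarrow> (2 \<Rightarrow> 2 \<Rightarrow> cyl) \<Rightarrow> (2 \<Rightarrow> cyl^2 \<Rightarrow> cyl^2) \<Rightarrow> bool" where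
  "is_levi_civita hbar h D \<longleftrightarrow>
     affine_connection hbar D \<and>
     (\<forall>i X Y. cyl_deriv i (herm_form hbar h X Y) =
        herm_form hbar h (D i X) Y + herm_form hbar h X (D i Y)) \<and>
     (\<forall>i j. D i (basis j) = D j (basis i)) \<and>
     (\<forall>i j l. cyl_star hbar (herm_form hbar h (D i (basis j)) (basis l)) =
        herm_form hbar h (D i (basis j)) (basis l))"

definition levi_civita :: "real \<Rightarrow> (2 \<Rightarrow> 2 \<Rightarrow> cyl) \<Rightarrow> 2 \<Rightarrow> cyl^2 \<Rightarrow> cyl^2" where
  "levi_civita hbar h = (THE D. is_levi_civita hbar h D)"

definition curvature :: "(2 \<Rightarrow> cyl^2 \<Rightarrow> cyl^2) \<Rightarrow> 2 \<Rightarrow> 2 \<Rightarrow> cyl^2 \<Rightarrow> cyl^2" where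
  "curvature D i j X = D i (D j X) - D j (D i X)"

definition riemann :: "real \<Rightarrow> (2 \<Rightarrow> 2 \<Rightarrow> cyl) \<Rightarrow> 2 \<Rightarrow> 2 \<Rightarrow> 2 \<Rightarrow> 2 \<Rightarrow> cyl" where
  "riemann hbar h i j p q =
     herm_form hbar h (basis i) (curvature (levi_civita hbar h) p q (basis j))"

definition conf_metric :: "(real \<Rightarrow> real) \<Rightarrow> 2 \<Rightarrow> 2 \<Rightarrow> cyl" where
  "conf_metric k i j = (if i = j then cyl_fun (\<lambda>u. of_real (exp (2 * k u))) else 0)"

definition conf_metric_inv :: "(real \<Rightarrow> real) \<Rightarrow> 2 \<Rightarrow> 2 \<Rightarrow> cyl" where
  "conf_metric_inv k i j = (if i = j then cyl_fun (\<lambda>u. of_real (exp (- 2 * k u))) else 0)"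

definition gaussian_curvature :: "real \<Rightarrow> (real \<Rightarrow> real) \<Rightarrow> cyl" where
  "gaussian_curvature hbar k = (1 / 2) *\<^sub>R
     (\<Sum>i\<in>UNIV. \<Sum>j\<in>UNIV. \<Sum>p\<in>UNIV. \<Sum>q\<in>UNIV.
        conf_metric_inv k i j \<star>\<^bsub>hbar\<^esub> riemann hbar (conf_metric k) i p j q \<star>\<^bsub>hbar\<^esub> conf_metric_inv k p q)"


section \<open>Integration\<close>

text \<open>
  For continuous functions the Henstock-Kurzweil integral over the whole line is the
  improper integral (possibly only conditionally convergent), i.e. the limit of the integrals over
  \<open>[a, b]\<close> as \<open>a\<close> and \<open>b\<close> tend independently to \<open>- \<infinity>\<close> and \<open>\<infinity>\<close>. The Lebesgue integral would
  not do, as \<open>k''\<close> need not be absolutely integrable.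
\<close>

definition tau_integrable :: "cyl \<Rightarrow> bool" where
  "tau_integrable f \<longleftrightarrow> coeff f 0 integrable_on UNIV"

definition tau :: "cyl \<Rightarrow> complex" where
  "tau f = integral UNIV (coeff f 0)"

definition riemannian_integrable :: "real \<Rightarrow> (real \<Rightarrow> real) \<Rightarrow> cyl \<Rightarrow> bool" where
  "riemannian_integrable hbar k f \<longleftrightarrow>
     tau_integrable (f \<star>\<^bsub>hbar\<^esub> cyl_fun (\<lambda>u. of_real (exp (2 * k u))))"

definition riemannian_integral :: "real \<Rightarrow> (real \<Rightarrow> real) \<Rightarrow> cyl \<Rightarrow> complex" where
  "riemannian_integral hbar k f = tau (f \<star>\<^bsub>hbar\<^esub> cyl_fun (\<lambda>u. of_real (exp (2 * k u))))"

definition total_curvature_exists :: "real \<Rightarrow> (real \<Rightarrow> real) \<Rightarrow> bool" where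
  "total_curvature_exists hbar k \<longleftrightarrow> riemannian_integrable hbar k (gaussian_curvature hbar k)"

definition total_curvature :: "real \<Rightarrow> (real \<Rightarrow> real) \<Rightarrow> complex" where
  "total_curvature hbar k = riemannian_integral hbar k (gaussian_curvature hbar k)"

end

(*
  A metric connection for which the components h(D_i e_j, e_l) are hermitian satisfies the Koszul
  formula on the basis, so a nondegenerate metric has at most one Levi-Civita connection. For a
  conformal metric all connection coefficients are 0, k' or -k'; these are functions of u and
  commute with the metric although they do not commute with the rest of the algebra. This gives
  R(d_1, d_2) e_1 = e_2 k'' and R(d_1, d_2) e_2 = - e_1 k'', hence K = - exp(-2k) k''. The weight
  exp(2k) of the Riemannian integral cancels the exponential, and the total curvature is the
  improper integral of -k''.
*)
theory Submission
  imports Defs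
begin

section \<open>Smooth functions\<close>

lemma smooth_differentiable: "smooth f \<Longrightarrow> f differentiable (at u)"
  using smooth_def[of f] by (metis funpow_0)

lemma smooth_has_vector_derivative:
  "smooth f \<Longrightarrow> (f has_vector_derivative vderiv f u) (at u)"
  using smooth_differentiable vector_derivative_works by blast

text \<open>Bridges two notions of derivative: the limits are assumed for \<open>deriv\<close>,
  while smoothness and the derivation use \<open>vderiv\<close>.\<close>

lemma smooth_deriv_eq_vderiv:
  fixes f :: "real \<Rightarrow> real"
  assumes "smooth f"
  shows "deriv f = vderiv f"
  using smooth_has_vector_derivative[OF assms]
  by (auto simp: fun_eq_iff has_real_derivative_iff_has_vector_derivative[symmetric] DERIV_imp_deriv)

text \<open>In the derivative \<open>exp (f u) * vderiv f u\<close>, the first factor is covered by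
  the induction hypothesis for the same \<open>f\<close>, the second by the premise of order
  \<open>Suc n\<close>.\<close>

lemma Cn_exp:
  fixes f :: "real \<Rightarrow> real"
  shows "Cn n f \<Longrightarrow> Cn n (\<lambda>u. exp (f u))"
proof (induction n)
  case (Suc n)
  then have d: "\<And>u. f differentiable (at u)" by (auto simp: Cn_Suc)
  have v: "((\<lambda>u. exp (f u)) has_vector_derivative exp (f u) * vderiv f u) (at u)" for u
    using d[of u]
    by (auto simp: vector_derivative_works has_real_derivative_iff_has_vector_derivative[symmetric]
        intro!: derivative_eq_intros)
  then have e: "vderiv (\<lambda>u. exp (f u)) = (\<lambda>u. exp (f u) * vderiv f u)"
    by (auto simp: fun_eq_iff intro!: vector_derivative_at)
  have "Cn n f" using Suc.prems Cn_mono le_SucI by blast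
  then show ?case using Suc v unfolding Cn_Suc e
    by (auto intro: differentiableI_vector Cn_mult)
qed (rule Cn_0)

lemma smooth_exp: "smooth f \<Longrightarrow> smooth (\<lambda>u. exp (f u :: real))"
  by (simp add: smooth_Cn Cn_exp)

lemma smooth_of_real: "smooth f \<Longrightarrow> smooth (\<lambda>u. complex_of_real (f u))"
  by (rule smooth_bounded_linear[OF bounded_linear_of_real])

lemma smooth_exp_cmult:
  fixes c :: real
  shows "smooth f \<Longrightarrow> smooth (\<lambda>u. exp (c * f u))"
  by (intro smooth_exp smooth_mult smooth_const)

text \<open>The simplifier pulls the sign out of \<open>- 2 * k u\<close>; this is the shape that
  then has to match.\<close>

lemma smooth_exp_minus_cmult:
  fixes c :: real
  shows "smooth f \<Longrightarrow> smooth (\<lambda>u. exp (- (c * f u)))"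
  using smooth_exp_cmult[of f "- c"] by simp

lemma vderiv_of_real:
  assumes "smooth f"
  shows "vderiv (\<lambda>u. complex_of_real (f u)) u = of_real (vderiv f u)"
  using bounded_linear.has_vector_derivative[OF bounded_linear_of_real
      smooth_has_vector_derivative[OF assms]]
  by (intro vector_derivative_at)

lemma vderiv_exp_cmult:
  fixes f :: "real \<Rightarrow> real"
  assumes "smooth f"
  shows "vderiv (\<lambda>u. exp (c * f u)) u = c * (exp (c * f u) * vderiv f u)"
proof -
  have "(f has_real_derivative vderiv f u) (at u)"
    using smooth_has_vector_derivative[OF assms]
    by (simp add: has_real_derivative_iff_has_vector_derivative)
  then have "((\<lambda>u. exp (c * f u)) has_real_derivative c * (exp (c * f u) * vderiv f u)) (at u)"
    by (auto intro!: derivative_eq_intros)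
  then show ?thesis
    by (simp add: has_real_derivative_iff_has_vector_derivative vector_derivative_at)
qed

text \<open>Over a box the integral is \<open>F y - F x\<close>, and the two ends converge
  independently. The Henstock-Kurzweil integral accepts this limit without absolute
  integrability.\<close>

lemma fundamental_theorem_of_calculus_UNIV:
  fixes F f :: "real \<Rightarrow> real"
  assumes F: "\<And>u. (F has_vector_derivative f u) (at u)"
    and bot: "(F \<longlongrightarrow> a) at_bot" and top: "(F \<longlongrightarrow> b) at_top"
  shows "(f has_integral (b - a)) UNIV"
proof -
  have I: "(f has_integral (F y - F x)) (cbox x y)" if "x \<le> y" for x y
    using that by (simp add: fundamental_theorem_of_calculus F has_vector_derivative_at_within)
  \<comment> \<open>Integrability is demanded on every box, including the empty ones with
    \<open>x > y\<close>.\<close>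
  have int: "f integrable_on cbox x y" for x y
    using I[of x y] by (cases "x \<le> y") (auto simp: integrable_on_def)
  show ?thesis
    unfolding has_integral_alt'
  proof (intro conjI allI impI)
    fix e :: real assume "e > 0"
    then have e: "e / 2 > 0" by simp
    obtain M where M: "\<And>x. x \<le> M \<Longrightarrow> dist (F x) a < e / 2"
      using tendstoD[OF bot e] by (auto simp: eventually_at_bot_linorder)
    obtain N where N: "\<And>x. x \<ge> N \<Longrightarrow> dist (F x) b < e / 2"
      using tendstoD[OF top e] by (auto simp: eventually_at_top_linorder)
    \<comment> \<open>The 1 makes \<open>B\<close> positive; the absolute values give
      \<open>- B \<le> M\<close> and \<open>N \<le> B\<close>.\<close>
    define B where "B = max 1 (max \<bar>M\<bar> \<bar>N\<bar>)"
    have B: "B > 0" "- B \<le> M" "N \<le> B" by (auto simp: B_def)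
    show "\<exists>B>0. \<forall>x y. ball 0 B \<subseteq> cbox x y \<longrightarrow>
        norm (integral (cbox x y) (\<lambda>u. if u \<in> UNIV then f u else 0) - (b - a)) < e"
    proof (intro exI conjI allI impI)
      fix x y :: real assume "ball 0 B \<subseteq> cbox x y"
      then have "{- B<..<B} \<subseteq> {x..y}" by (simp add: ball_eq_greaterThanLessThan)
      then have xy: "x \<le> - B" "B \<le> y" using B
        by (simp_all add: greaterThanLessThan_subseteq_atLeastAtMost_iff)
      then have "integral (cbox x y) f = F y - F x"
        using B by (intro integral_unique I) auto
      moreover have "dist (F x) a < e / 2" "dist (F y) b < e / 2"
        using xy B M[of x] N[of y] by linarith+
      ultimately show "norm (integral (cbox x y) (\<lambda>u. if u \<in> UNIV then f u else 0) - (b - a)) < e"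
        unfolding dist_real_def abs_less_iff real_norm_def by simp
    qed (rule B)
  qed (use int in simp)
qed


section \<open>The algebra structure of the noncommutative cylinder\<close>

lemma cyl_eqI: "(\<And>n u. coeff f n u = coeff g n u) \<Longrightarrow> f = g"
  by (intro iffD1[OF coeff_inject] ext)

lemma smooth_coeff: "smooth (coeff f n)"
  using coeff[of f] by simp

lemma finite_support: "finite {n. coeff f n \<noteq> (\<lambda>u. 0)}"
  using coeff[of f] by simp

lemmas coeff_simps = zero_cyl.rep_eq plus_cyl.rep_eq uminus_cyl.rep_eq scaleR_cyl.rep_eq
  cyl_star.rep_eq cyl_d1.rep_eq cyl_d2.rep_eq cyl_fun.rep_eq

text \<open>The product is defined by a sum over the exact support of the left factor. Allowing any
  finite superset lets the sums of different products share one index set.\<close>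

lemma coeff_mult:
  assumes "finite S" "\<And>m. m \<notin> S \<Longrightarrow> coeff f m = (\<lambda>u. 0)"
  shows "coeff (f \<star>\<^bsub>hbar\<^esub> g) n u = (\<Sum>m\<in>S. coeff f m u * coeff g (n - m) (u + of_int m * hbar))"
  unfolding cyl_mult.rep_eq
  by (rule sum.mono_neutral_left) (use assms in \<open>auto simp: fun_eq_iff\<close>)

text \<open>A shift by \<open>l * hbar\<close> followed by one by \<open>p * hbar\<close> is a shift
  by \<open>(l + p) * hbar\<close>; the rest is an interchange of finite sums.\<close>

lemma cyl_mult_assoc: "f \<star>\<^bsub>hbar\<^esub> g \<star>\<^bsub>hbar\<^esub> h = f \<star>\<^bsub>hbar\<^esub> (g \<star>\<^bsub>hbar\<^esub> h)"
proof (rule cyl_eqI)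
  fix n u
  define S where "S = {n. coeff f n \<noteq> (\<lambda>u. 0)}"
  define T where "T = {n. coeff g n \<noteq> (\<lambda>u. 0)}"
  \<comment> \<open>The sumset of the two supports contains every index at which the product of
    \<open>f\<close> and \<open>g\<close> can be nonzero.\<close>
  define P where "P = (\<lambda>(a, b). a + b) ` (S \<times> T)"
  have fin: "finite S" "finite T" "finite P"
    by (auto simp: S_def T_def P_def finite_support)
  have S: "\<And>m. m \<notin> S \<Longrightarrow> coeff f m = (\<lambda>u. 0)" and T: "\<And>m. m \<notin> T \<Longrightarrow> coeff g m = (\<lambda>u. 0)"
    by (auto simp: S_def T_def)
  have P: "l \<in> S \<Longrightarrow> p \<in> T \<Longrightarrow> l + p \<in> P" for l p
    by (auto simp: P_def)
  have fg: "coeff (f \<star>\<^bsub>hbar\<^esub> g) m v = (\<Sum>l\<in>S. coeff f l v * coeff g (m - l) (v + of_int l * hbar))" for m v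
    by (rule coeff_mult[OF fin(1) S])
  have "coeff (f \<star>\<^bsub>hbar\<^esub> g) m = (\<lambda>u. 0)" if "m \<notin> P" for m
  proof
    fix v
    have "coeff g (m - l) = (\<lambda>u. 0)" if "l \<in> S" for l
      using P[OF that, of "m - l"] \<open>m \<notin> P\<close> T by auto
    then show "coeff (f \<star>\<^bsub>hbar\<^esub> g) m v = 0"
      unfolding fg by (intro sum.neutral) simp
  qed
  then have "coeff (f \<star>\<^bsub>hbar\<^esub> g \<star>\<^bsub>hbar\<^esub> h) n u =
      (\<Sum>m\<in>P. coeff (f \<star>\<^bsub>hbar\<^esub> g) m u * coeff h (n - m) (u + of_int m * hbar))"
    by (intro coeff_mult[OF fin(3)])
  also have "\<dots> = (\<Sum>l\<in>S. \<Sum>m\<in>P. coeff f l u *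
      (coeff g (m - l) (u + of_int l * hbar) * coeff h (n - m) (u + of_int m * hbar)))"
    unfolding fg by (subst sum.swap) (simp add: sum_distrib_right mult.assoc)
  also have "\<dots> = (\<Sum>l\<in>S. coeff f l u * coeff (g \<star>\<^bsub>hbar\<^esub> h) (n - l) (u + of_int l * hbar))"
  proof (rule sum.cong)
    fix l assume l: "l \<in> S"
    \<comment> \<open>For \<open>l\<close> in \<open>S\<close> the translate of \<open>P\<close> by
      \<open>- l\<close> still contains the support of \<open>g\<close>, and
      \<open>p = m - l\<close> turns the sum into one over \<open>P\<close>.\<close>
    have "coeff (g \<star>\<^bsub>hbar\<^esub> h) (n - l) (u + of_int l * hbar) =
        (\<Sum>p\<in>(\<lambda>m. m - l) ` P. coeff g p (u + of_int l * hbar) *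
          coeff h (n - l - p) (u + of_int l * hbar + of_int p * hbar))"
      by (rule coeff_mult) (use fin P[OF l] T in \<open>force simp: image_iff\<close>)+
    also have "\<dots> = (\<Sum>m\<in>P. coeff g (m - l) (u + of_int l * hbar) * coeff h (n - m) (u + of_int m * hbar))"
      by (subst sum.reindex) (auto simp: inj_on_def algebra_simps)
    finally show "(\<Sum>m\<in>P. coeff f l u *
      (coeff g (m - l) (u + of_int l * hbar) * coeff h (n - m) (u + of_int m * hbar))) =
      coeff f l u * coeff (g \<star>\<^bsub>hbar\<^esub> h) (n - l) (u + of_int l * hbar)"
      by (simp add: sum_distrib_left)
  qed simp
  also have "\<dots> = coeff (f \<star>\<^bsub>hbar\<^esub> (g \<star>\<^bsub>hbar\<^esub> h)) n u"
    by (rule coeff_mult[OF fin(1) S, symmetric])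
  finally show "coeff (f \<star>\<^bsub>hbar\<^esub> g \<star>\<^bsub>hbar\<^esub> h) n u = coeff (f \<star>\<^bsub>hbar\<^esub> (g \<star>\<^bsub>hbar\<^esub> h)) n u" .
qed

section \<open>Bilinearity of the product\<close>

lemma cyl_mult_add_right: "f \<star>\<^bsub>hbar\<^esub> (g + h) = f \<star>\<^bsub>hbar\<^esub> g + f \<star>\<^bsub>hbar\<^esub> h"
  by (rule cyl_eqI) (simp add: coeff_simps cyl_mult.rep_eq algebra_simps sum.distrib)

lemma cyl_mult_scaleR_right: "f \<star>\<^bsub>hbar\<^esub> (r *\<^sub>R g) = r *\<^sub>R (f \<star>\<^bsub>hbar\<^esub> g)"
  by (rule cyl_eqI) (simp add: coeff_simps cyl_mult.rep_eq scaleR_right.sum)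

text \<open>Here the index set varies with the left factor; the union of the supports of
  \<open>f\<close> and \<open>g\<close> serves for all three products.\<close>

lemma cyl_mult_add_left: "(f + g) \<star>\<^bsub>hbar\<^esub> h = f \<star>\<^bsub>hbar\<^esub> h + g \<star>\<^bsub>hbar\<^esub> h"
proof (rule cyl_eqI)
  fix n u
  let ?S = "{n. coeff f n \<noteq> (\<lambda>u. 0)} \<union> {n. coeff g n \<noteq> (\<lambda>u. 0)}"
  have c: "coeff x n u = (\<Sum>m\<in>?S. coeff y m u * coeff h (n - m) (u + of_int m * hbar))"
    if "x = y \<star>\<^bsub>hbar\<^esub> h" "y \<in> {f, g, f + g}" for x y
    unfolding that(1) by (rule coeff_mult) (use that(2) in \<open>auto simp: finite_support coeff_simps\<close>)
  show "coeff ((f + g) \<star>\<^bsub>hbar\<^esub> h) n u = coeff (f \<star>\<^bsub>hbar\<^esub> h + g \<star>\<^bsub>hbar\<^esub> h) n u"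
    by (simp add: plus_cyl.rep_eq c[OF refl] algebra_simps sum.distrib)
qed

lemma cyl_mult_scaleR_left: "(r *\<^sub>R f) \<star>\<^bsub>hbar\<^esub> g = r *\<^sub>R (f \<star>\<^bsub>hbar\<^esub> g)"
proof (rule cyl_eqI)
  fix n u
  \<comment> \<open>The support shrinks when \<open>r = 0\<close>, so both sums are taken over the
    support of \<open>f\<close>.\<close>
  show "coeff ((r *\<^sub>R f) \<star>\<^bsub>hbar\<^esub> g) n u = coeff (r *\<^sub>R (f \<star>\<^bsub>hbar\<^esub> g)) n u"
    by (subst coeff_mult[OF finite_support[of f]])
      (auto simp: coeff_simps cyl_mult.rep_eq scaleR_right.sum fun_eq_iff)
qed

lemma cyl_mult_minus_right: "f \<star>\<^bsub>hbar\<^esub> (- g) = - (f \<star>\<^bsub>hbar\<^esub> g)"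
  using cyl_mult_scaleR_right[of hbar f "-1" g] by simp

lemma cyl_mult_minus_left: "(- f) \<star>\<^bsub>hbar\<^esub> g = - (f \<star>\<^bsub>hbar\<^esub> g)"
  using cyl_mult_scaleR_left[of hbar "-1" f g] by simp

lemma cyl_mult_0_right: "f \<star>\<^bsub>hbar\<^esub> 0 = 0"
  using cyl_mult_scaleR_right[of hbar f 0 0] by simp

lemma cyl_mult_0_left: "0 \<star>\<^bsub>hbar\<^esub> g = 0"
  using cyl_mult_scaleR_left[of hbar 0 0 g] by simp

lemma cyl_mult_diff_right: "f \<star>\<^bsub>hbar\<^esub> (g - h) = f \<star>\<^bsub>hbar\<^esub> g - f \<star>\<^bsub>hbar\<^esub> h"
  using cyl_mult_add_right[where f = f and g = g and h = "- h"] by (simp add: cyl_mult_minus_right)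

lemma cyl_mult_diff_left: "(f - g) \<star>\<^bsub>hbar\<^esub> h = f \<star>\<^bsub>hbar\<^esub> h - g \<star>\<^bsub>hbar\<^esub> h"
  using cyl_mult_add_left[where f = f and g = "- g" and h = h] by (simp add: cyl_mult_minus_left)

lemmas cyl_algebra_simps = cyl_mult_diff_left cyl_mult_diff_right cyl_mult_assoc cyl_mult_add_left cyl_mult_add_right
  cyl_mult_scaleR_left cyl_mult_scaleR_right cyl_mult_minus_left cyl_mult_minus_right
  cyl_mult_0_left cyl_mult_0_right

section \<open>The involution\<close>

lemma cyl_star_add: "cyl_star hbar (f + g) = cyl_star hbar f + cyl_star hbar g"
  by (rule cyl_eqI) (simp add: coeff_simps)

lemma cyl_star_minus: "cyl_star hbar (- f) = - cyl_star hbar f"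
  by (rule cyl_eqI) (simp add: coeff_simps)

lemma cyl_star_0: "cyl_star hbar 0 = 0"
  by (rule cyl_eqI) (simp add: coeff_simps)

lemma cyl_star_star: "cyl_star hbar (cyl_star hbar f) = f"
  by (rule cyl_eqI) (simp add: coeff_simps)

lemma cyl_star_mult: "cyl_star hbar (f \<star>\<^bsub>hbar\<^esub> g) = cyl_star hbar g \<star>\<^bsub>hbar\<^esub> cyl_star hbar f"
proof (rule cyl_eqI)
  fix n u
  \<comment> \<open>The substitution \<open>p = m + n\<close> exchanges the two products. The
    translated set ensures that the reindexed sum covers the support of
    \<open>cyl_star hbar g\<close>.\<close>
  define S where "S = {m. coeff f m \<noteq> (\<lambda>u. 0)} \<union>
    (\<lambda>p. p - n) ` {p. coeff (cyl_star hbar g) p \<noteq> (\<lambda>u. 0)}"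
  have fin: "finite S" by (simp add: S_def finite_support)
  have "coeff (cyl_star hbar (f \<star>\<^bsub>hbar\<^esub> g)) n u =
      cnj (\<Sum>m\<in>S. coeff f m (u + of_int n * hbar) * coeff g (- n - m) (u + of_int n * hbar + of_int m * hbar))"
    by (simp only: cyl_star.rep_eq) (subst coeff_mult[OF fin], auto simp: S_def)
  also have "\<dots> = (\<Sum>p\<in>(\<lambda>m. m + n) ` S. coeff (cyl_star hbar g) p u *
      coeff (cyl_star hbar f) (n - p) (u + of_int p * hbar))"
    by (subst sum.reindex) (auto simp: inj_on_def cyl_star.rep_eq algebra_simps minus_diff_commute)
  also have "\<dots> = coeff (cyl_star hbar g \<star>\<^bsub>hbar\<^esub> cyl_star hbar f) n u"
    by (rule coeff_mult[symmetric]) (use fin in \<open>force simp: S_def image_iff\<close>)+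
  finally show "coeff (cyl_star hbar (f \<star>\<^bsub>hbar\<^esub> g)) n u =
    coeff (cyl_star hbar g \<star>\<^bsub>hbar\<^esub> cyl_star hbar f) n u" .
qed

section \<open>The two derivations\<close>

lemma cyl_d1_add: "cyl_d1 (f + g) = cyl_d1 f + cyl_d1 g"
  by (rule cyl_eqI) (auto simp: coeff_simps intro!: vector_derivative_at
      has_vector_derivative_add smooth_has_vector_derivative smooth_coeff)

text \<open>Translation commutes with differentiation, so the ordinary product rule applies to each
  term.\<close>

lemma cyl_d1_mult: "cyl_d1 (f \<star>\<^bsub>hbar\<^esub> g) = cyl_d1 f \<star>\<^bsub>hbar\<^esub> g + f \<star>\<^bsub>hbar\<^esub> cyl_d1 g"
proof (rule cyl_eqI)
  fix n u
  let ?S = "{m. coeff f m \<noteq> (\<lambda>u. 0)}"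
  have D: "((\<lambda>v. coeff f m v * coeff g l (v + c)) has_vector_derivative
      coeff f m u * vderiv (coeff g l) (u + c) + vderiv (coeff f m) u * coeff g l (u + c)) (at u)"
    for m l c
  proof (rule has_vector_derivative_mult)
    have "((coeff g l \<circ> (\<lambda>v. v + c)) has_vector_derivative 1 *\<^sub>R vderiv (coeff g l) (u + c)) (at u)"
      by (intro vector_diff_chain_at smooth_has_vector_derivative smooth_coeff)
        (auto intro!: derivative_eq_intros)
    then show "((\<lambda>v. coeff g l (v + c)) has_vector_derivative vderiv (coeff g l) (u + c)) (at u)"
      by (simp add: o_def)
  qed (intro smooth_has_vector_derivative smooth_coeff)
  have "coeff (f \<star>\<^bsub>hbar\<^esub> g) n = (\<lambda>v. \<Sum>m\<in>?S. coeff f m v * coeff g (n - m) (v + of_int m * hbar))"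
    by (simp add: cyl_mult.rep_eq fun_eq_iff)
  then have "coeff (cyl_d1 (f \<star>\<^bsub>hbar\<^esub> g)) n u =
      (\<Sum>m\<in>?S. coeff f m u * vderiv (coeff g (n - m)) (u + of_int m * hbar) +
        vderiv (coeff f m) u * coeff g (n - m) (u + of_int m * hbar))"
    unfolding cyl_d1.rep_eq
    by (simp only:) (intro vector_derivative_at has_vector_derivative_sum D)
  \<comment> \<open>A zero coefficient has zero derivative, so the support of \<open>f\<close> also
    suffices for \<open>cyl_d1 f\<close>.\<close>
  moreover have "coeff (cyl_d1 f \<star>\<^bsub>hbar\<^esub> g) n u =
      (\<Sum>m\<in>?S. coeff (cyl_d1 f) m u * coeff g (n - m) (u + of_int m * hbar))"
    by (rule coeff_mult) (auto simp: finite_support cyl_d1.rep_eq)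
  moreover have "coeff (f \<star>\<^bsub>hbar\<^esub> cyl_d1 g) n u =
      (\<Sum>m\<in>?S. coeff f m u * coeff (cyl_d1 g) (n - m) (u + of_int m * hbar))"
    by (rule coeff_mult) (auto simp: finite_support)
  ultimately show "coeff (cyl_d1 (f \<star>\<^bsub>hbar\<^esub> g)) n u = coeff (cyl_d1 f \<star>\<^bsub>hbar\<^esub> g + f \<star>\<^bsub>hbar\<^esub> cyl_d1 g) n u"
    by (simp add: plus_cyl.rep_eq cyl_d1.rep_eq sum.distrib)
qed

lemma cyl_d2_add: "cyl_d2 (f + g) = cyl_d2 f + cyl_d2 g"
  by (rule cyl_eqI) (simp add: coeff_simps algebra_simps)

text \<open>The degree is additive: the factor proportional to \<open>n\<close> splits along
  \<open>n = m + (n - m)\<close>.\<close>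

lemma cyl_d2_mult: "cyl_d2 (f \<star>\<^bsub>hbar\<^esub> g) = cyl_d2 f \<star>\<^bsub>hbar\<^esub> g + f \<star>\<^bsub>hbar\<^esub> cyl_d2 g"
proof (rule cyl_eqI)
  fix n u
  let ?S = "{m. coeff f m \<noteq> (\<lambda>u. 0)}"
  have "coeff (cyl_d2 f \<star>\<^bsub>hbar\<^esub> g) n u =
      (\<Sum>m\<in>?S. coeff (cyl_d2 f) m u * coeff g (n - m) (u + of_int m * hbar))"
    by (rule coeff_mult) (auto simp: finite_support cyl_d2.rep_eq)
  then show "coeff (cyl_d2 (f \<star>\<^bsub>hbar\<^esub> g)) n u = coeff (cyl_d2 f \<star>\<^bsub>hbar\<^esub> g + f \<star>\<^bsub>hbar\<^esub> cyl_d2 g) n u"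
    by (simp add: plus_cyl.rep_eq cyl_d2.rep_eq cyl_mult.rep_eq sum_distrib_left
        sum.distrib[symmetric] algebra_simps)
qed

lemma cyl_d1_star: "cyl_d1 (cyl_star hbar f) = cyl_star hbar (cyl_d1 f)"
proof (rule cyl_eqI)
  fix n u
  let ?c = "of_int n * hbar"
  have "((coeff f (- n) \<circ> (\<lambda>v. v + ?c)) has_vector_derivative
      1 *\<^sub>R vderiv (coeff f (- n)) (u + ?c)) (at u)"
    by (intro vector_diff_chain_at smooth_has_vector_derivative smooth_coeff)
      (auto intro!: derivative_eq_intros)
  then have "((\<lambda>v. cnj (coeff f (- n) (v + ?c))) has_vector_derivative
      cnj (vderiv (coeff f (- n)) (u + ?c))) (at u)"
    by (intro bounded_linear.has_vector_derivative[OF bounded_linear_cnj]) (simp add: o_def)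
  then show "coeff (cyl_d1 (cyl_star hbar f)) n u = coeff (cyl_star hbar (cyl_d1 f)) n u"
    by (simp add: cyl_d1.rep_eq cyl_star.rep_eq vector_derivative_at)
qed

text \<open>The sign from conjugating the imaginary unit cancels the one from the index
  \<open>- n\<close>.\<close>

lemma cyl_d2_star: "cyl_d2 (cyl_star hbar f) = cyl_star hbar (cyl_d2 f)"
  by (rule cyl_eqI) (simp add: coeff_simps)

lemma cyl_deriv_add: "cyl_deriv i (f + g) = cyl_deriv i f + cyl_deriv i g"
  by (simp add: cyl_deriv_def cyl_d1_add cyl_d2_add)

lemma cyl_deriv_mult:
  "cyl_deriv i (f \<star>\<^bsub>hbar\<^esub> g) = cyl_deriv i f \<star>\<^bsub>hbar\<^esub> g + f \<star>\<^bsub>hbar\<^esub> cyl_deriv i g"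
  by (simp add: cyl_deriv_def cyl_d1_mult cyl_d2_mult)

lemma cyl_deriv_star: "cyl_deriv i (cyl_star hbar f) = cyl_star hbar (cyl_deriv i f)"
  by (simp add: cyl_deriv_def cyl_d1_star cyl_d2_star)

lemma cyl_deriv_0: "cyl_deriv i 0 = 0"
  using cyl_deriv_add[of i 0 0] by simp

lemma cyl_deriv_minus: "cyl_deriv i (- f) = - cyl_deriv i f"
  using cyl_deriv_add[of i f "- f"] by (simp add: cyl_deriv_0 eq_neg_iff_add_eq_0 add.commute)

section \<open>Functions of u as elements of the algebra\<close>

lemma coeff_cyl_fun_mult:
  assumes "smooth a"
  shows "coeff (cyl_fun a \<star>\<^bsub>hbar\<^esub> f) n u = a u * coeff f n u"
  using coeff_mult[of "{0}" "cyl_fun a" hbar f n u] assms by (simp add: cyl_fun.rep_eq)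

text \<open>Moving \<open>a\<close> to the left past the n-th power of W translates its argument by
  \<open>n * hbar\<close>. Left and right multiplication by \<open>a\<close> therefore agree in
  degree 0, but in general not elsewhere.\<close>

lemma coeff_mult_cyl_fun:
  assumes "smooth a"
  shows "coeff (f \<star>\<^bsub>hbar\<^esub> cyl_fun a) n u = coeff f n u * a (u + of_int n * hbar)"
proof -
  \<comment> \<open>With \<open>n\<close> inserted, the only term that can survive is present even
    if \<open>coeff f n\<close> vanishes.\<close>
  let ?S = "insert n {m. coeff f m \<noteq> (\<lambda>u. 0)}"
  have "coeff (f \<star>\<^bsub>hbar\<^esub> cyl_fun a) n u =
      (\<Sum>m\<in>?S. coeff f m u * coeff (cyl_fun a) (n - m) (u + of_int m * hbar))"
    by (rule coeff_mult) (auto simp: finite_support)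
  also have "\<dots> = (\<Sum>m\<in>?S. if m = n then coeff f n u * a (u + of_int n * hbar) else 0)"
    by (rule sum.cong) (use assms in \<open>auto simp: cyl_fun.rep_eq\<close>)
  finally show ?thesis by (simp add: finite_support)
qed

lemma cyl_fun_1_mult: "cyl_fun (\<lambda>u. 1) \<star>\<^bsub>hbar\<^esub> f = f"
  by (rule cyl_eqI) (simp add: coeff_cyl_fun_mult smooth_const)

lemma cyl_mult_fun_1: "f \<star>\<^bsub>hbar\<^esub> cyl_fun (\<lambda>u. 1) = f"
  by (rule cyl_eqI) (simp add: coeff_mult_cyl_fun smooth_const)

lemma cyl_fun_mult:
  "smooth a \<Longrightarrow> smooth b \<Longrightarrow> cyl_fun a \<star>\<^bsub>hbar\<^esub> cyl_fun b = cyl_fun (\<lambda>u. a u * b u)"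
  by (rule cyl_eqI) (simp add: coeff_cyl_fun_mult cyl_fun.rep_eq smooth_mult)

lemma cyl_star_fun: "smooth a \<Longrightarrow> cyl_star hbar (cyl_fun a) = cyl_fun (\<lambda>u. cnj (a u))"
  by (rule cyl_eqI) (simp add: coeff_simps smooth_bounded_linear[OF bounded_linear_cnj])

lemma cyl_star_of_real:
  "smooth a \<Longrightarrow> cyl_star hbar (cyl_fun (\<lambda>u. of_real (a u))) = cyl_fun (\<lambda>u. of_real (a u))"
  by (simp add: cyl_star_fun smooth_of_real)

lemma cyl_star_1: "cyl_star hbar (cyl_fun (\<lambda>u. 1)) = cyl_fun (\<lambda>u. 1)"
  by (simp add: cyl_star_fun smooth_const)

lemma cyl_d1_fun: "smooth a \<Longrightarrow> cyl_d1 (cyl_fun a) = cyl_fun (vderiv a)"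
  by (rule cyl_eqI) (auto simp: coeff_simps smooth_vderiv)

lemma cyl_d2_fun: "cyl_d2 (cyl_fun a) = 0"
  by (rule cyl_eqI) (simp add: coeff_simps)

text \<open>Since 1 = 1 * 1, its derivative equals twice itself. The value 0 of \<open>hbar\<close>
  is an arbitrary choice, as the derivations do not depend on it.\<close>

lemma cyl_deriv_1: "cyl_deriv i (cyl_fun (\<lambda>u. 1)) = 0"
  using cyl_deriv_mult[of i 0 "cyl_fun (\<lambda>u. 1)" "cyl_fun (\<lambda>u. 1)"]
  by (simp add: cyl_fun_1_mult cyl_mult_fun_1)


section \<open>The Levi-Civita connection\<close>

lemma herm_form_basis_right:
  "herm_form hbar h X (basis l) = (\<Sum>i\<in>UNIV. cyl_star hbar (X $ i) \<star>\<^bsub>hbar\<^esub> h i l)"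
  unfolding herm_form_def basis_def axis_def
  using exhaust_2[of l] by (auto simp: sum_2 cyl_mult_fun_1 cyl_mult_0_right)

lemma herm_form_star:
  assumes "\<And>i j. cyl_star hbar (h i j) = h j i"
  shows "cyl_star hbar (herm_form hbar h X Y) = herm_form hbar h Y X"
  by (simp add: herm_form_def sum_2 cyl_star_add cyl_star_mult cyl_star_star assms cyl_mult_assoc
      add_ac)

text \<open>Hermiticity of \<open>h(\<nabla>\<^sub>i e\<^sub>j, e\<^sub>l)\<close> makes up for the missing symmetry of the form, so that the
  classical permutation argument for the Koszul formula goes through.\<close>

lemma levi_civita_koszul:
  assumes D: "is_levi_civita hbar h D" and h: "\<And>i j. cyl_star hbar (h i j) = h j i"
  shows "2 *\<^sub>R herm_form hbar h (D i (basis j)) (basis l) =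
    cyl_deriv i (herm_form hbar h (basis j) (basis l)) +
    cyl_deriv j (herm_form hbar h (basis i) (basis l)) -
    cyl_deriv l (herm_form hbar h (basis i) (basis j))"
proof -
  define G where "G i j l = herm_form hbar h (D i (basis j)) (basis l)" for i j l
  \<comment> \<open>The left side is the adjoint of \<open>G i l j\<close>, which is
    hermitian.\<close>
  have "herm_form hbar h (basis j) (D i (basis l)) = G i l j" for i j l
    using D herm_form_star[of hbar h "D i (basis l)" "basis j", OF h]
    by (simp add: is_levi_civita_def G_def)
  then have metric: "cyl_deriv i (herm_form hbar h (basis j) (basis l)) = G i j l + G i l j" for i j l
    using D by (simp add: is_levi_civita_def G_def)
  have "G i j l = G j i l" for i j l
    using D by (simp add: is_levi_civita_def G_def)
  \<comment> \<open>Three fixed instances of torsion-freeness suffice; under them the six metric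
    terms collapse to \<open>G i j l\<close> taken twice.\<close>
  then have "G i l j = G l i j" "G j l i = G l j i" "G j i l = G i j l" by auto
  then show ?thesis unfolding metric G_def[symmetric]
    by (simp add: scaleR_2)
qed

text \<open>Writing X as the sum of the basis vectors times its components, additivity and the
  Leibniz rule express \<open>D i X\<close> through the values on the basis.\<close>

lemma affine_connection_eqI:
  assumes D: "affine_connection hbar D" and D': "affine_connection hbar D'"
    and basis: "\<And>i j. D i (basis j) = D' i (basis j)"
  shows "D = D'"
proof (intro ext)
  fix i X
  have "X = rmult hbar (basis 1) (X $ 1) + rmult hbar (basis 2) (X $ 2)"
    by (simp add: vec_eq_iff forall_2 rmult_def basis_def axis_def cyl_fun_1_mult cyl_mult_0_left)
  moreover have "E i (rmult hbar (basis 1) (X $ 1) + rmult hbar (basis 2) (X $ 2)) =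
     rmult hbar (E i (basis 1)) (X $ 1) + rmult hbar (basis 1) (cyl_deriv i (X $ 1)) +
     (rmult hbar (E i (basis 2)) (X $ 2) + rmult hbar (basis 2) (cyl_deriv i (X $ 2)))"
    if "affine_connection hbar E" for E
    using that by (simp add: affine_connection_def)
  ultimately show "D i X = D' i X"
    using D D' basis by metis
qed

text \<open>The right side of the Koszul formula does not involve the connection; nondegeneracy then
  recovers its values on the basis.\<close>

lemma levi_civita_unique:
  assumes D: "is_levi_civita hbar h D" "is_levi_civita hbar h D'"
    and h: "\<And>i j. cyl_star hbar (h i j) = h j i"
    and nondegenerate: "\<And>X Y. (\<And>l. herm_form hbar h X (basis l) = herm_form hbar h Y (basis l)) \<Longrightarrow> X = Y"
  shows "D = D'"
proof (rule affine_connection_eqI[of hbar])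
  show "D i (basis j) = D' i (basis j)" for i j
  proof (rule nondegenerate)
    fix l
    have "(2::real) *\<^sub>R herm_form hbar h (D i (basis j)) (basis l) =
        2 *\<^sub>R herm_form hbar h (D' i (basis j)) (basis l)"
      by (simp only: levi_civita_koszul[OF D(1) h] levi_civita_koszul[OF D(2) h])
    then show "herm_form hbar h (D i (basis j)) (basis l) = herm_form hbar h (D' i (basis j)) (basis l)"
      by simp
  qed
qed (use D in \<open>simp_all add: is_levi_civita_def\<close>)

text \<open>Leibniz extension of the stated basis values: k' acts as a scalar for i = 1 and through
  a quarter turn for i = 2. It stands to the left of the components because these multiply the basis
  from the right.\<close>

definition conf_connection :: "real \<Rightarrow> (real \<Rightarrow> real) \<Rightarrow> 2 \<Rightarrow> cyl^2 \<Rightarrow> cyl^2" where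
  "conf_connection hbar k i X = (\<chi> l. cyl_deriv i (X $ l) +
     cyl_fun (\<lambda>u. of_real (vderiv k u)) \<star>\<^bsub>hbar\<^esub>
       (if i = 1 then X $ l else if l = 1 then - (X $ 2) else X $ 1))"

section \<open>The Levi-Civita connection of a conformal metric\<close>

context
  fixes k :: "real \<Rightarrow> real"
  assumes k: "smooth k"
begin

lemma herm_form_conf_metric:
  "herm_form hbar (conf_metric k) X Y =
    cyl_star hbar (X $ 1) \<star>\<^bsub>hbar\<^esub> (cyl_fun (\<lambda>u. of_real (exp (2 * k u))) \<star>\<^bsub>hbar\<^esub> Y $ 1) +
    cyl_star hbar (X $ 2) \<star>\<^bsub>hbar\<^esub> (cyl_fun (\<lambda>u. of_real (exp (2 * k u))) \<star>\<^bsub>hbar\<^esub> Y $ 2)"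
  by (simp add: herm_form_def sum_2 conf_metric_def cyl_algebra_simps)

lemma conf_metric_star: "cyl_star hbar (conf_metric k i j) = conf_metric k j i"
  by (simp add: conf_metric_def cyl_star_of_real cyl_star_0 smooth_exp_cmult k)

lemma exp_mult_inverse:
  "cyl_fun (\<lambda>u. of_real (exp (2 * k u))) \<star>\<^bsub>hbar\<^esub> cyl_fun (\<lambda>u. of_real (exp (- 2 * k u))) = cyl_fun (\<lambda>u. 1)"
  using k by (subst cyl_fun_mult)
    (auto intro!: smooth_of_real smooth_exp_cmult smooth_exp_minus_cmult simp: of_real_mult[symmetric] exp_add[symmetric]
      simp del: of_real_mult)

text \<open>Right multiplication by \<open>exp (- 2 * k u)\<close> recovers the adjoint of each
  component, and the involution is injective.\<close>

lemma conf_metric_nondegenerate: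
  assumes "\<And>l. herm_form hbar (conf_metric k) X (basis l) = herm_form hbar (conf_metric k) Y (basis l)"
  shows "X = Y"
proof -
  let ?H = "cyl_fun (\<lambda>u. of_real (exp (2 * k u)))" and ?I = "cyl_fun (\<lambda>u. of_real (exp (- 2 * k u)))"
  have *: "herm_form hbar (conf_metric k) Z (basis l) = cyl_star hbar (Z $ l) \<star>\<^bsub>hbar\<^esub> ?H" for Z l
    unfolding herm_form_basis_right using exhaust_2[of l]
    by (auto simp: sum_2 conf_metric_def cyl_mult_0_right)
  show ?thesis unfolding vec_eq_iff
  proof
    fix l
    have "cyl_star hbar (X $ l) \<star>\<^bsub>hbar\<^esub> ?H \<star>\<^bsub>hbar\<^esub> ?I = cyl_star hbar (Y $ l) \<star>\<^bsub>hbar\<^esub> ?H \<star>\<^bsub>hbar\<^esub> ?I"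
      using assms[of l] unfolding * by simp
    then have "cyl_star hbar (X $ l) = cyl_star hbar (Y $ l)"
      unfolding cyl_mult_assoc exp_mult_inverse cyl_mult_fun_1 .
    then show "X $ l = Y $ l" by (metis cyl_star_star)
  qed
qed

text \<open>Both functions have degree 0, so neither gets shifted. The trailing \<open>f\<close>
  makes the rule applicable to products nested to the right.\<close>

lemma vderiv_exp_commute:
  "cyl_fun (\<lambda>u. of_real (vderiv k u)) \<star>\<^bsub>hbar\<^esub> (cyl_fun (\<lambda>u. of_real (exp (2 * k u))) \<star>\<^bsub>hbar\<^esub> f) =
   cyl_fun (\<lambda>u. of_real (exp (2 * k u))) \<star>\<^bsub>hbar\<^esub> (cyl_fun (\<lambda>u. of_real (vderiv k u)) \<star>\<^bsub>hbar\<^esub> f)"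
  using k by (intro cyl_eqI)
    (simp add: coeff_cyl_fun_mult smooth_of_real smooth_exp_cmult smooth_vderiv)

text \<open>The factor 2 is what metric compatibility distributes evenly over the two arguments of
  the form.\<close>

lemma cyl_deriv_exp:
  "cyl_deriv i (cyl_fun (\<lambda>u. of_real (exp (2 * k u)))) = (if i = 1 then
    2 *\<^sub>R (cyl_fun (\<lambda>u. of_real (exp (2 * k u))) \<star>\<^bsub>hbar\<^esub> cyl_fun (\<lambda>u. of_real (vderiv k u))) else 0)"
  using k by (intro cyl_eqI)
    (auto simp: cyl_deriv_def cyl_d2_fun cyl_d1_fun smooth_of_real smooth_exp_cmult smooth_vderiv
      coeff_cyl_fun_mult scaleR_cyl.rep_eq cyl_fun.rep_eq vderiv_of_real vderiv_exp_cmult smooth_mult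
      smooth_const scaleR_conv_of_real)

lemma affine_connection_conf: "affine_connection hbar (conf_connection hbar k)"
  by (auto simp: affine_connection_def conf_connection_def vec_eq_iff forall_2 rmult_def
      cyl_deriv_add cyl_deriv_mult cyl_algebra_simps add_ac)

lemma conf_connection_basis:
  "conf_connection hbar k i (basis j) =
    (let K = cyl_fun (\<lambda>u. of_real (vderiv k u)) in
     if i = 1 then axis j K else if j = 1 then axis 2 K else axis 1 (- K))"
  using exhaust_2[of j]
  by (auto simp: conf_connection_def Let_def basis_def axis_def vec_eq_iff forall_2 cyl_deriv_0
      cyl_deriv_1 cyl_mult_fun_1 cyl_algebra_simps)

lemma is_levi_civita_conf: "is_levi_civita hbar (conf_metric k) (conf_connection hbar k)"
  unfolding is_levi_civita_def
proof (intro conjI allI)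
  fix i j l :: 2 and X Y
  let ?H = "cyl_fun (\<lambda>u. of_real (exp (2 * k u)))" and ?K = "cyl_fun (\<lambda>u. of_real (vderiv k u))"
  have K: "cyl_star hbar ?K = ?K" by (simp add: cyl_star_of_real smooth_vderiv k)
  have H: "cyl_star hbar ?H = ?H" by (simp add: cyl_star_of_real smooth_exp_cmult k)
  have HK: "?K \<star>\<^bsub>hbar\<^esub> ?H = ?H \<star>\<^bsub>hbar\<^esub> ?K"
    using vderiv_exp_commute[of hbar "cyl_fun (\<lambda>u. 1)"] by (simp add: cyl_mult_fun_1)
  show "affine_connection hbar (conf_connection hbar k)" by (rule affine_connection_conf)
  show "cyl_deriv i (herm_form hbar (conf_metric k) X Y) =
      herm_form hbar (conf_metric k) (conf_connection hbar k i X) Y +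
      herm_form hbar (conf_metric k) X (conf_connection hbar k i Y)"
    \<comment> \<open>For i = 1 each argument contributes one k' times the metric. For i = 2 the
      quarter turn is skew, and its terms cancel because k' commutes with the metric.\<close>
    using exhaust_2[of i]
    by (auto simp: herm_form_conf_metric conf_connection_def cyl_deriv_add cyl_deriv_mult
        cyl_deriv_star cyl_star_add cyl_star_mult cyl_star_minus K cyl_deriv_exp[of _ hbar]
        cyl_algebra_simps vderiv_exp_commute scaleR_2 add_ac)
  show "conf_connection hbar k i (basis j) = conf_connection hbar k j (basis i)"
    using exhaust_2[of i] exhaust_2[of j] by (auto simp: conf_connection_basis Let_def)
  \<comment> \<open>Every such component is 0 or, up to sign, the real function k' exp(2k).\<close>
  show "cyl_star hbar (herm_form hbar (conf_metric k) (conf_connection hbar k i (basis j)) (basis l)) =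
      herm_form hbar (conf_metric k) (conf_connection hbar k i (basis j)) (basis l)"
    unfolding conf_connection_basis
    using exhaust_2[of i] exhaust_2[of j] exhaust_2[of l]
    by (auto simp: herm_form_conf_metric Let_def basis_def axis_def
        cyl_star_add cyl_star_mult cyl_star_minus cyl_star_0 K H HK cyl_star_1 cyl_mult_fun_1 cyl_fun_1_mult
        cyl_algebra_simps)
qed

text \<open>Existence and uniqueness together evaluate the definite description.\<close>

lemma levi_civita_conf: "levi_civita hbar (conf_metric k) = conf_connection hbar k"
  unfolding levi_civita_def
proof (rule the_equality)
  fix D assume "is_levi_civita hbar (conf_metric k) D"
  from this is_levi_civita_conf conf_metric_star conf_metric_nondegenerate
  show "D = conf_connection hbar k" by (rule levi_civita_unique)
qed (rule is_levi_civita_conf)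


section \<open>Curvature\<close>

text \<open>The terms quadratic in k' cancel in the commutator, and the second derivation kills k';
  only the first derivative of k' remains.\<close>

lemma curvature_conf_basis:
  "curvature (conf_connection hbar k) 1 2 (basis 1) = axis 2 (cyl_fun (\<lambda>u. of_real (vderiv (vderiv k) u)))"
  "curvature (conf_connection hbar k) 1 2 (basis 2) = - axis 1 (cyl_fun (\<lambda>u. of_real (vderiv (vderiv k) u)))"
proof -
  have "cyl_deriv 1 (cyl_fun (\<lambda>u. of_real (vderiv k u))) = cyl_fun (\<lambda>u. of_real (vderiv (vderiv k) u))"
    "cyl_deriv 2 (cyl_fun (\<lambda>u. of_real (vderiv k u))) = 0"
    by (simp_all add: cyl_deriv_def cyl_d2_fun cyl_d1_fun smooth_of_real smooth_vderiv vderiv_of_real k)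
  then show
    "curvature (conf_connection hbar k) 1 2 (basis 1) = axis 2 (cyl_fun (\<lambda>u. of_real (vderiv (vderiv k) u)))"
    "curvature (conf_connection hbar k) 1 2 (basis 2) = - axis 1 (cyl_fun (\<lambda>u. of_real (vderiv (vderiv k) u)))"
    \<comment> \<open>The inner derivatives of basis vectors are evaluated first; the outer ones act
      on general vectors and need the full formula.\<close>
    by (simp_all add: curvature_def conf_connection_basis Let_def vec_eq_iff forall_2)
      (simp_all add: conf_connection_def axis_def cyl_deriv_0 cyl_deriv_minus
        cyl_algebra_simps)
qed

text \<open>Antisymmetry in the derivations leaves R_1212 and R_2121. Both equal - exp(2k) k'', so
  the factor 1/2 removes the doubling, and one of the two inverse metrics cancels the
  exponential.\<close>

lemma gaussian_curvature_conf:
  "gaussian_curvature hbar k = - cyl_fun (\<lambda>u. of_real (exp (- 2 * k u) * vderiv (vderiv k) u))"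
proof -
  let ?H = "cyl_fun (\<lambda>u. of_real (exp (2 * k u)))" and ?I = "cyl_fun (\<lambda>u. of_real (exp (- 2 * k u)))"
  let ?L = "cyl_fun (\<lambda>u. of_real (vderiv (vderiv k) u))"
  have half: "(1 / 2) *\<^sub>R (- A - A) = - A" for A :: cyl
    unfolding diff_conv_add_uminus scaleR_2[symmetric] by simp
  have antisym: "curvature D 2 1 X = - curvature D 1 2 X" "curvature D i i X = 0" for D i X
    by (simp_all add: curvature_def)
  have "?I \<star>\<^bsub>hbar\<^esub> (?H \<star>\<^bsub>hbar\<^esub> ?L \<star>\<^bsub>hbar\<^esub> ?I) = cyl_fun (\<lambda>u. of_real (exp (- 2 * k u) * vderiv (vderiv k) u))"
    using k by (intro cyl_eqI, auto simp: coeff_cyl_fun_mult cyl_mult_assoc cyl_fun.rep_eq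
        smooth_of_real smooth_exp_cmult smooth_exp_minus_cmult smooth_vderiv smooth_mult)
      (simp_all add: exp_minus)
  then show ?thesis
    unfolding gaussian_curvature_def riemann_def levi_civita_conf
    by (simp add: sum_2 conf_metric_inv_def antisym curvature_conf_basis cyl_mult_0_left cyl_mult_0_right)
      (simp add: herm_form_conf_metric axis_def basis_def cyl_star_1 cyl_star_0 cyl_fun_1_mult
        cyl_algebra_simps half)
qed

section \<open>Total curvature as an improper integral\<close>

lemma total_curvature_has_integral:
  assumes "(deriv k \<longlongrightarrow> a) at_bot" and "(deriv k \<longlongrightarrow> b) at_top"
  shows "(coeff (gaussian_curvature hbar k \<star>\<^bsub>hbar\<^esub> cyl_fun (\<lambda>u. of_real (exp (2 * k u)))) 0
    has_integral complex_of_real (a - b)) UNIV"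
proof -
  \<comment> \<open>In degree 0 the right factor is not shifted, so the two exponentials cancel
    pointwise for every \<open>hbar\<close>.\<close>
  have "coeff (gaussian_curvature hbar k \<star>\<^bsub>hbar\<^esub> cyl_fun (\<lambda>u. of_real (exp (2 * k u)))) 0 =
      (\<lambda>u. - complex_of_real (vderiv (vderiv k) u))"
    using k by (intro ext, simp add: gaussian_curvature_conf coeff_mult_cyl_fun uminus_cyl.rep_eq
        cyl_fun.rep_eq smooth_of_real smooth_exp_cmult smooth_exp_minus_cmult smooth_vderiv smooth_mult)
      (simp_all add: exp_minus)
  moreover have "(vderiv (vderiv k) has_integral (b - a)) UNIV"
    using assms k by (intro fundamental_theorem_of_calculus_UNIV[of "vderiv k"])
      (auto simp: smooth_deriv_eq_vderiv intro: smooth_has_vector_derivative smooth_vderiv)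
  then have "((\<lambda>u. - complex_of_real (vderiv (vderiv k) u)) has_integral - of_real (b - a)) UNIV"
    by (intro has_integral_neg has_integral_of_real)
  ultimately show ?thesis by simp
qed

lemma total_curvature_eq:
  assumes "(deriv k \<longlongrightarrow> a) at_bot" and "(deriv k \<longlongrightarrow> b) at_top"
  shows "total_curvature_exists hbar k" "total_curvature hbar k = complex_of_real (a - b)"
  using total_curvature_has_integral[OF assms, of hbar]
  by (auto simp: total_curvature_exists_def total_curvature_def riemannian_integrable_def
      riemannian_integral_def tau_integrable_def tau_def integrable_on_def integral_unique)

end

theorem mainTheorem11:
  fixes hbar a b :: real and k :: "real \<Rightarrow> real"
  assumes "smooth k"
    and "(deriv k \<longlongrightarrow> a) at_bot"
    and "(deriv k \<longlongrightarrow> b) at_top"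
  shows "total_curvature_exists hbar k \<and>
    total_curvature hbar k = complex_of_real (a - b) \<and>
    (\<forall>\<delta> :: real \<Rightarrow> real. \<forall>d :: real.
       smooth \<delta> \<longrightarrow> (deriv \<delta> \<longlongrightarrow> d) at_top \<longrightarrow> (deriv \<delta> \<longlongrightarrow> d) at_bot \<longrightarrow>
       total_curvature_exists hbar (\<lambda>u. k u + \<delta> u) \<and>
       total_curvature hbar (\<lambda>u. k u + \<delta> u) = total_curvature hbar k)"
proof -
  have "total_curvature_exists hbar (\<lambda>u. k u + \<delta> u)"
    "total_curvature hbar (\<lambda>u. k u + \<delta> u) = complex_of_real (a - b)"
    if \<delta>: "smooth \<delta>" "(deriv \<delta> \<longlongrightarrow> d) at_top" "(deriv \<delta> \<longlongrightarrow> d) at_bot" for \<delta> :: "real \<Rightarrow> real" and d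
  proof -
    have s: "smooth (\<lambda>u. k u + \<delta> u)" using assms(1) \<delta>(1) by (rule smooth_add)
    have "deriv (\<lambda>u. k u + \<delta> u) = (\<lambda>u. deriv k u + deriv \<delta> u)"
      using assms(1) \<delta>(1) s
      by (auto simp: smooth_deriv_eq_vderiv fun_eq_iff intro!: vector_derivative_at
          has_vector_derivative_add smooth_has_vector_derivative)
    \<comment> \<open>Both limits move by the same \<open>d\<close>, which drops out of their
      difference.\<close>
    then have "(deriv (\<lambda>u. k u + \<delta> u) \<longlongrightarrow> a + d) at_bot" "(deriv (\<lambda>u. k u + \<delta> u) \<longlongrightarrow> b + d) at_top"
      using assms(2,3) \<delta>(2,3) by (auto intro: tendsto_add)
    from total_curvature_eq[OF s this, of hbar]
    show "total_curvature_exists hbar (\<lambda>u. k u + \<delta> u)"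
      "total_curvature hbar (\<lambda>u. k u + \<delta> u) = complex_of_real (a - b)"
      by simp_all
  qed
  with total_curvature_eq[OF assms, of hbar] show ?thesis by simp
qed

end
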